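(* Let $\mathcal{H}$ be a complex Hilbert space and let $T\in\mathcal{B}(\mathcal{H})$ have closed range. Then the following are equivalent: (1) $T$ is EP. (2) There exists an isomorphism $V\in\mathcal{B}(\mathcal{H})$ such that $T^*T=VTT^*$. (3) There exists an injective $N\in\mathcal{B}(\mathcal{H})$ such that $T^*T=NTT^*$. (4) There exist $S_1,S_2\in\mathcal{B}(\mathcal{H})$ such that $T^*T=S_1TT^*$ and $TT^*=S_2T^*T$.
   Context: $\mathcal{B}(\mathcal{H})$ denotes the bounded linear operators on $\mathcal{H}$. $\mathcal{N}(T)$ is the kernel of $T$ and $T^*$ its adjoint. An operator $T\in\mathcal{B}(\mathcal{H})$ with closed range is called EP if $\mathcal{N}(T)=\mathcal{N}(T^* )$. A bounded operator is an isomorphism if it is injective and onto (not necessarily isometric). *)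

theory Defs
  imports "HOL-Analysis.Analysis"
begin

text \<open>
  The library has only real inner product spaces, so a complex one is given as a real one
  carrying a compatible complex structure. Its real inner product, and hence its norm and
  topology, are those induced by the complex inner product; \<^term>\<open>Re (cinner x x)\<close> is the squared
  norm, so that positive definiteness of \<open>cinner\<close> comes from the class \<^class>\<open>real_inner\<close>.
  Convention: \<open>cinner\<close> is linear in the first argument and conjugate-linear in the second.
\<close>

class complex_inner = real_inner +
  fixes scaleC :: "complex \<Rightarrow> 'a \<Rightarrow> 'a"
    and cinner :: "'a \<Rightarrow> 'a \<Rightarrow> complex"
  assumes scaleC_add_right: "scaleC c (x + y) = scaleC c x + scaleC c y"
    and scaleC_add_left: "scaleC (c + d) x = scaleC c x + scaleC d x"
    and scaleC_scaleC: "scaleC c (scaleC d x) = scaleC (c * d) x"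
    and scaleC_of_real: "scaleC (complex_of_real r) x = scaleR r x"
    and cinner_commute: "cinner x y = cnj (cinner y x)"
    and cinner_add_left: "cinner (x + y) z = cinner x z + cinner y z"
    and cinner_scaleC_left: "cinner (scaleC c x) y = c * cinner x y"
    and inner_eq_Re_cinner: "inner x y = Re (cinner x y)"

class complex_hilbert_space = complex_inner + complete_space

locale bounded_clinear = bounded_linear f
  for f :: "'a::complex_inner \<Rightarrow> 'b::complex_inner" +
  assumes scaleC: "f (scaleC c x) = scaleC c (f x)"

definition kernel :: "('a::complex_inner \<Rightarrow> 'b::complex_inner) \<Rightarrow> 'a set"
  where "kernel T = {x. T x = 0}"

text \<open>
  Meaningful for bounded operators on a Hilbert space, where the Riesz representation theorem
  provides exactly one such function (which is again a bounded operator).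
\<close>

definition cadjoint ::
    "('a::complex_hilbert_space \<Rightarrow> 'a) \<Rightarrow> 'a \<Rightarrow> 'a"
  where "cadjoint T = (THE S. \<forall>x y. cinner (T x) y = cinner x (S y))"

definition EP :: "('a::complex_hilbert_space \<Rightarrow> 'a) \<Rightarrow> bool"
  where "EP T \<longleftrightarrow>
    bounded_clinear T \<and> closed (range T) \<and> kernel T = kernel (cadjoint T)"

definition isomorphism :: "('a::complex_hilbert_space \<Rightarrow> 'a) \<Rightarrow> bool"
  where "isomorphism V \<longleftrightarrow> bounded_clinear V \<and> inj V \<and> surj V"

end

theory Submission
  imports Defs
begin

text \<open>
  Each factorisation forces \<open>T\<close> to be EP by comparing kernels: \<open>ker (T\<^sup>* T) = ker T\<close> and
  \<open>ker (T T\<^sup>*) = ker T\<^sup>*\<close>, and an injective left factor leaves the kernel unchanged, while an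
  arbitrary linear left factor can only enlarge it, so that two of them in opposite directions
  also give equality (\<open>kernel_cadjoint_comp\<close>).

  For the converse let \<open>T\<close> be EP and let \<open>P\<close> be the orthogonal projection onto the common kernel
  \<open>K\<close> of \<open>T\<close> and \<open>T\<^sup>*\<close>. Since \<open>T\<close> has closed range, so has \<open>T\<^sup>*\<close> (\<open>closed_range_adjoint\<close>), and
  both operators are bounded below on \<open>K\<^sup>\<bottom>\<close> (\<open>closed_range_adjoint_below\<close>). Therefore
  \<open>A = T T\<^sup>* + P\<close> and \<open>B = T\<^sup>* T + P\<close> are coercive, hence bijective with bounded inverses
  (\<open>bij_compose_adjoint_plus_projection\<close>). Both map \<open>x - P x\<close> to the part without \<open>P\<close>, so
  \<open>V = B A\<^sup>-\<^sup>1\<close> is an isomorphism with \<open>T\<^sup>* T = V T T\<^sup>*\<close>, and its inverse \<open>A B\<^sup>-\<^sup>1\<close> gives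
  \<open>T T\<^sup>* = A B\<^sup>-\<^sup>1 T\<^sup>* T\<close> (\<open>EP_imp_factorisation\<close>).

  The analysis takes place in the underlying real Hilbert space; complex linearity is added at
  the end.
\<close>

section \<open>Orthogonality and duality in a real Hilbert space\<close>

text \<open>
  The Riesz representation theorem relative to a closed subspace, obtained by minimising
  \<open>\<parallel>x\<parallel>\<^sup>2 - 2 f x\<close> there. Taking the whole space gives adjoints; taking \<open>f = inner x\<close> gives the
  orthogonal projection onto the subspace.
\<close>

lemma closed_subspace_riesz:
  fixes f :: "'a::{real_inner,complete_space} \<Rightarrow> real"
  assumes f: "bounded_linear f" and S: "subspace S" "closed S"
  obtains u where "u \<in> S" "\<And>v. v \<in> S \<Longrightarrow> inner u v = f v"
proof -
  interpret f: bounded_linear f by fact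
  define q where "q x = (norm x)\<^sup>2 - 2 * f x" for x
  define m where "m = Inf (q ` S)"
  obtain K where K: "\<And>x. norm (f x) \<le> norm x * K"
    using f.bounded by blast
  have lower: "q x \<ge> - (K\<^sup>2)" for x
  proof -
    have "0 \<le> (norm x - K)\<^sup>2" by simp
    also have "\<dots> = (norm x)\<^sup>2 - 2 * (norm x * K) + K\<^sup>2"
      by (simp add: power2_diff)
    finally show ?thesis
      using K[of x] unfolding q_def by (simp add: abs_le_iff)
  qed
  then have bdd: "bdd_below (q ` S)" by (meson bdd_belowI2)
  have "0 \<in> S" using S(1) by (rule subspace_0)
  have m_le: "m \<le> q x" if "x \<in> S" for x
    unfolding m_def using bdd that by (simp add: cINF_lower)
  have "\<exists>x\<in>S. q x < m + 1 / real (Suc n)" for n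
  proof -
    have "Inf (q ` S) < m + 1 / real (Suc n)" unfolding m_def by simp
    then show ?thesis
      using \<open>0 \<in> S\<close> bdd by (subst (asm) cInf_less_iff) auto
  qed
  then obtain X where XS: "\<And>n. X n \<in> S" and Xq: "\<And>n. q (X n) < m + 1 / real (Suc n)"
    by metis
  \<comment> \<open>parallelogram law: the linear part of \<open>q\<close> cancels at the midpoint\<close>
  have para: "(dist a b)\<^sup>2 \<le> 2 * (q a - m) + 2 * (q b - m)" if "a \<in> S" "b \<in> S" for a b
  proof -
    define c where "c = (1/2) *\<^sub>R (a + b)"
    have "c \<in> S" unfolding c_def using S(1) that by (simp add: subspace_add subspace_scale)
    have "(dist a b)\<^sup>2 = 2 * q a + 2 * q b - 4 * q c"
      unfolding q_def c_def dist_norm power2_norm_eq_inner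
      by (simp add: f.scaleR f.add inner_add inner_diff inner_commute algebra_simps)
    then show ?thesis using m_le[OF \<open>c \<in> S\<close>] by simp
  qed
  have "Cauchy X"
  proof (rule metric_CauchyI)
    fix e :: real assume "e > 0"
    obtain N where N: "4 / e\<^sup>2 < real N" using reals_Archimedean2 by blast
    have "dist (X i) (X j) < e" if "i \<ge> N" "j \<ge> N" for i j
    proof -
      have bnd: "4 * (q (X k) - m) < e\<^sup>2" if "k \<ge> N" for k
      proof -
        have "4 / e\<^sup>2 < real (Suc k)" using N that by linarith
        then have "4 * (1 / real (Suc k)) < e\<^sup>2"
          using \<open>e > 0\<close> by (simp add: field_simps)
        then show ?thesis using Xq[of k] by argo
      qed
      have "(dist (X i) (X j))\<^sup>2 < e\<^sup>2"
        using para[OF XS XS, of i j] bnd[OF that(1)] bnd[OF that(2)] by argo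
      then show ?thesis using \<open>e > 0\<close> by (simp add: power_less_imp_less_base)
    qed
    then show "\<exists>M. \<forall>i\<ge>M. \<forall>j\<ge>M. dist (X i) (X j) < e" by blast
  qed
  then obtain u where u: "X \<longlonglongrightarrow> u" using Cauchy_convergent convergent_def by blast
  have uS: "u \<in> S" using S(2) XS u closed_sequentially by blast
  have "(\<lambda>n. q (X n)) \<longlonglongrightarrow> q u"
    unfolding q_def by (intro tendsto_intros u f.tendsto)
  moreover have "(\<lambda>n. m + 1 / real (Suc n)) \<longlonglongrightarrow> m + 0"
    by (intro tendsto_intros LIMSEQ_Suc[OF lim_1_over_n])
  ultimately have "q u \<le> m"
    using LIMSEQ_le[of "\<lambda>n. q (X n)" "q u" "\<lambda>n. m + 1 / real (Suc n)" m] Xq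
    by (auto intro: less_imp_le)
  have "inner u v = f v" if v: "v \<in> S" for v
  proof -
    define d where "d = f v - inner u v"
    define s where "s = (norm v)\<^sup>2 + 1"
    have s: "s > 0" unfolding s_def by (simp add: add_nonneg_pos)
    have expand: "q (u + r *\<^sub>R v) = q u - 2 * r * d + r\<^sup>2 * (s - 1)" for r
      unfolding q_def d_def s_def power2_norm_eq_inner
      by (simp add: f.scaleR f.add inner_add inner_commute algebra_simps power2_eq_square)
    \<comment> \<open>a step of the optimal order from the minimiser along \<open>v\<close> cannot lower \<open>q\<close>, so \<open>d = 0\<close>\<close>
    have "u + (d / s) *\<^sub>R v \<in> S" using S(1) uS v by (simp add: subspace_add subspace_scale)
    then have "q u \<le> q (u + (d / s) *\<^sub>R v)" using m_le \<open>q u \<le> m\<close> by fastforce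
    also have "\<dots> = q u - 2 * (d / s) * d + (d / s)\<^sup>2 * (s - 1)"
      by (rule expand)
    finally have "2 * (d / s) * d \<le> (d / s)\<^sup>2 * (s - 1)" by simp
    moreover have "2 * (d / s) * d = (d / s)\<^sup>2 * (2 * s)"
      using s by (simp add: power2_eq_square)
    ultimately have "(d / s)\<^sup>2 * (s + 1) \<le> 0" by (simp add: algebra_simps)
    then have "d = 0" using s by (simp add: mult_le_0_iff)
    then show ?thesis unfolding d_def by simp
  qed
  then show ?thesis using that uS by blast
qed

lemma adjoint_exists:
  fixes T :: "'a::{real_inner,complete_space} \<Rightarrow> 'a"
  assumes T: "bounded_linear T"
  obtains S where "bounded_linear S" "\<And>x y. inner (T x) y = inner x (S y)"
proof -
  interpret T: bounded_linear T by fact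
  have "\<exists>u. \<forall>x. inner (T x) y = inner x u" for y
  proof -
    have "bounded_linear (\<lambda>x. inner (T x) y)"
      using T by (rule bounded_linear_inner_left_comp)
    then obtain u where "\<And>x. inner u x = inner (T x) y"
      using closed_subspace_riesz[of "\<lambda>x. inner (T x) y" UNIV] by auto
    then show ?thesis by (metis inner_commute)
  qed
  then obtain S where S: "\<And>x y. inner (T x) y = inner x (S y)" by metis
  have eqI: "a = b" if "\<And>x. inner x a = inner x b" for a b :: 'a
    using that[of "a - b"] by (metis inner_diff_right inner_eq_zero_iff right_minus_eq)
  obtain K where K: "K > 0" "\<And>x. norm (T x) \<le> norm x * K"
    using T.pos_bounded by blast
  have "bounded_linear S"
  proof (rule bounded_linear_intro)
    show "S (x + y) = S x + S y" for x y
      by (rule eqI) (simp add: S[symmetric] inner_add_right)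
    show "S (r *\<^sub>R x) = r *\<^sub>R S x" for r x
      by (rule eqI) (simp add: S[symmetric])
    show "norm (S x) \<le> norm x * K" for x
    proof (cases "S x = 0")
      case False
      have "norm (S x) * norm (S x) = inner (T (S x)) x"
        by (simp add: S power2_norm_eq_inner[symmetric] power2_eq_square)
      also have "\<dots> \<le> norm (T (S x)) * norm x" by (rule norm_cauchy_schwarz)
      also have "\<dots> \<le> (norm (S x) * K) * norm x" by (intro mult_right_mono K) simp
      finally show ?thesis using False by (simp add: mult.commute mult.left_commute)
    qed (use K in simp)
  qed
  then show ?thesis using that S by blast
qed

lemma orthogonal_projection_exists:
  fixes K :: "'a::{real_inner,complete_space} set"
  assumes K: "subspace K" "closed K"
  obtains P where "bounded_linear P" "\<And>x. P x \<in> K" "\<And>x k. k \<in> K \<Longrightarrow> inner (x - P x) k = 0"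
proof -
  have "\<exists>u. u \<in> K \<and> (\<forall>k\<in>K. inner (x - u) k = 0)" for x
  proof -
    obtain u where "u \<in> K" "\<And>v. v \<in> K \<Longrightarrow> inner u v = inner x v"
      using closed_subspace_riesz[OF bounded_linear_inner_right[of x] K] by blast
    then show ?thesis by (auto simp: inner_diff_left)
  qed
  then obtain P where PK: "\<And>x. P x \<in> K" and P: "\<And>x k. k \<in> K \<Longrightarrow> inner (x - P x) k = 0"
    by metis
  have eqI: "a = b" if "a \<in> K" "b \<in> K" "\<And>k. k \<in> K \<Longrightarrow> inner a k = inner b k" for a b
  proof -
    have "a - b \<in> K" using K(1) that by (simp add: subspace_diff)
    then have "inner (a - b) (a - b) = 0" using that(3) by (simp add: inner_diff_left)
    then show ?thesis by simp
  qed
  have P': "inner (P x) k = inner x k" if "k \<in> K" for x k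
    using P[OF that, of x] by (simp add: inner_diff_left)
  have "bounded_linear P"
  proof (rule bounded_linear_intro)
    show "P (x + y) = P x + P y" for x y
      by (rule eqI) (use K(1) PK in \<open>auto simp: P' inner_add_left subspace_add\<close>)
    show "P (r *\<^sub>R x) = r *\<^sub>R P x" for r x
      by (rule eqI) (use K(1) PK in \<open>auto simp: P' subspace_scale\<close>)
    show "norm (P x) \<le> norm x * 1" for x
    proof (cases "P x = 0")
      case False
      have "norm (P x) * norm (P x) = inner x (P x)"
        using P'[OF PK, of x x] by (simp add: power2_norm_eq_inner[symmetric] power2_eq_square)
      also have "\<dots> \<le> norm x * norm (P x)" by (rule norm_cauchy_schwarz)
      finally show ?thesis using False by simp
    qed simp
  qed
  then show ?thesis using that PK P by blast
qed

section \<open>Weakly bounded sets and coercive operators\<close>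

text \<open>
  The uniform boundedness principle for the functionals \<open>inner y\<close> with \<open>y \<in> Y\<close>, from the Baire
  category theorem.
\<close>

lemma weakly_bounded_imp_bounded:
  fixes Y :: "'a::{real_inner,complete_space} set"
  assumes Y: "\<And>z. \<exists>B. \<forall>y\<in>Y. \<bar>inner y z\<bar> \<le> B"
  shows "bounded Y"
proof -
  define F where "F n = {z. \<forall>y\<in>Y. \<bar>inner y z\<bar> \<le> real n}" for n :: nat
  have clF: "closed (F n)" for n
  proof -
    have "F n = (\<Inter>y\<in>Y. {z. \<bar>inner y z\<bar> \<le> real n})" unfolding F_def by auto
    moreover have "closed {z. \<bar>inner y z\<bar> \<le> real n}" for y :: 'a
      by (intro closed_Collect_le continuous_intros)
    ultimately show ?thesis by auto
  qed
  have "z \<in> \<Union>(range F)" for z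
  proof -
    obtain B where "\<forall>y\<in>Y. \<bar>inner y z\<bar> \<le> B" using Y by blast
    moreover obtain n where "B \<le> real n" using real_arch_simple by blast
    ultimately have "z \<in> F n" unfolding F_def by (auto intro: order_trans)
    then show ?thesis by blast
  qed
  then have cover: "\<Union>(range F) = UNIV" by blast
  have "\<exists>n. interior (F n) \<noteq> {}"
  proof (rule ccontr)
    assume "\<not> ?thesis"
    then have "interior (\<Union>(range F)) = {}"
      using Baire_category_alt[of "euclidean :: 'a topology" "range F"] clF
      by (force simp: completely_metrizable_space_euclidean)
    then show False using cover by simp
  qed
  then obtain n z0 where "z0 \<in> interior (F n)" by blast
  then obtain e where e: "e > 0" "ball z0 e \<subseteq> F n"
    unfolding mem_interior by blast
  have "norm y \<le> 4 * real n / e" if "y \<in> Y" for y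
  proof (cases "y = 0")
    case False
    define w where "w = (e / (2 * norm y)) *\<^sub>R y"
    have "norm w = e / 2" unfolding w_def using False e by simp
    then have "z0 \<in> F n" "z0 + w \<in> F n" using e by (auto simp: dist_norm)
    then have "\<bar>inner y z0\<bar> \<le> real n" "\<bar>inner y (z0 + w)\<bar> \<le> real n"
      using that unfolding F_def by auto
    then have "inner y w \<le> 2 * real n" by (simp add: inner_add_right)
    moreover have "inner y w = e * norm y / 2"
      unfolding w_def using False
      by (simp add: power2_norm_eq_inner[symmetric] power2_eq_square)
    ultimately show ?thesis using e by (simp add: field_simps)
  qed (use e in simp)
  then show ?thesis unfolding bounded_iff by blast
qed

text \<open>
  The Lax--Milgram theorem: for small \<open>t > 0\<close> the map \<open>x \<mapsto> x - t (A x - y)\<close> is a contraction, and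
  its fixed point solves \<open>A x = y\<close>.
\<close>

lemma coercive_imp_bij:
  fixes A :: "'a::{real_inner,complete_space} \<Rightarrow> 'a"
  assumes A: "bounded_linear A" and c: "c > 0" "\<And>x. c * (norm x)\<^sup>2 \<le> inner (A x) x"
  shows "bij A" "bounded_linear (inv A)"
proof -
  interpret A: bounded_linear A by fact
  have below: "c * norm x \<le> norm (A x)" for x
  proof (cases "x = 0")
    case False
    have "(c * norm x) * norm x \<le> norm (A x) * norm x"
      using c(2)[of x] norm_cauchy_schwarz[of "A x" x] by (simp add: power2_eq_square mult.assoc)
    then show ?thesis using False by simp
  qed simp
  have inj: "inj A"
  proof (rule injI)
    fix x y assume "A x = A y"
    then have "c * norm (x - y) \<le> 0" using below[of "x - y"] by (simp add: A.diff)
    then show "x = y" using c(1) by (simp add: mult_le_0_iff)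
  qed
  \<comment> \<open>\<open>M \<ge> c\<close> makes the squared contraction constant \<open>1 - c\<^sup>2 / M\<^sup>2\<close> nonnegative, also on the zero space\<close>
  obtain M where M: "M \<ge> c" "\<And>x. norm (A x) \<le> M * norm x"
  proof -
    obtain M0 where M0: "\<And>x. norm (A x) \<le> norm x * M0" using A.bounded by blast
    show thesis
    proof (rule that[of "max M0 c"])
      show "norm (A x) \<le> max M0 c * norm x" for x
        using M0[of x] mult_right_mono[of M0 "max M0 c" "norm x"] by (simp add: mult.commute)
    qed simp
  qed
  have "\<exists>x. A x = y" for y
  proof -
    \<comment> \<open>this \<open>t\<close> minimises \<open>1 - 2 t c + t\<^sup>2 M\<^sup>2\<close>, with minimum \<open>k\<close>\<close>
    define t where "t = c / M\<^sup>2"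
    define k where "k = 1 - t * c"
    define g where "g x = x - t *\<^sub>R (A x - y)" for x
    have t: "t > 0" and k: "0 \<le> k" "k < 1"
      using c(1) M(1) unfolding t_def k_def
      by (auto simp: power2_eq_square[symmetric] divide_le_eq power_mono)
    have "dist (g x) (g x') \<le> sqrt k * dist x x'" for x x'
    proof -
      define w where "w = x - x'"
      have "g x - g x' = w - t *\<^sub>R A w"
        unfolding g_def w_def by (simp add: A.diff algebra_simps)
      then have eq: "dist (g x) (g x') = norm (w - t *\<^sub>R A w)" by (simp add: dist_norm)
      have "(dist (g x) (g x'))\<^sup>2 = (norm w)\<^sup>2 - 2 * t * inner (A w) w + t\<^sup>2 * (norm (A w))\<^sup>2"
        unfolding eq power2_norm_eq_inner
        by (simp add: inner_diff inner_commute power2_eq_square algebra_simps)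
      also have "\<dots> \<le> (norm w)\<^sup>2 - 2 * t * (c * (norm w)\<^sup>2) + t\<^sup>2 * (M * norm w)\<^sup>2"
        using t c(2)[of w] M(2)[of w]
        by (intro add_mono diff_mono mult_left_mono power_mono) auto
      also have "\<dots> = k * (norm w)\<^sup>2"
        unfolding k_def t_def using c(1) M(1) by (simp add: field_simps power2_eq_square)
      also have "\<dots> = (sqrt k * dist x x')\<^sup>2"
        using k unfolding w_def by (simp add: power_mult_distrib dist_norm)
      finally show ?thesis by (rule power2_le_imp_le) (use k in simp)
    qed
    then have "\<exists>!x. g x = x"
      using k by (intro banach_fix_type[of "sqrt k"]) auto
    then obtain x where "g x = x" by blast
    then have "A x = y" using t unfolding g_def by simp
    then show ?thesis by blast
  qed
  then have "surj A" by (metis surjI)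
  with inj show bij: "bij A" by (simp add: bij_def)
  have A_inv: "A (inv A y) = y" for y using bij by (simp add: bij_is_surj surj_f_inv_f)
  have inv_A: "inv A (A x) = x" for x using inj by simp
  show "bounded_linear (inv A)"
  proof (rule bounded_linear_intro)
    show "inv A (x + y) = inv A x + inv A y" for x y
      by (metis A.add A_inv inv_A)
    show "inv A (r *\<^sub>R x) = r *\<^sub>R inv A x" for r x
      by (metis A.scaleR A_inv inv_A)
    show "norm (inv A x) \<le> norm x * (1 / c)" for x
      using below[of "inv A x"] c(1) by (simp add: A_inv field_simps)
  qed
qed

section \<open>Operators with closed range\<close>

text \<open>
  Let \<open>S\<close> be the adjoint of \<open>T\<close>. If \<open>y\<close> is orthogonal to \<open>ker S\<close> and \<open>\<parallel>S y\<parallel> \<le> 1\<close>, then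
  \<open>\<bar>inner y (T x)\<bar> = \<bar>inner x (S y)\<bar> \<le> \<parallel>x\<parallel>\<close>. Since \<open>range T\<close> is closed, every vector is the sum
  of one in \<open>range T\<close> and one in \<open>ker S\<close>, so all such \<open>y\<close> form a weakly bounded set. Its
  boundedness is the lower bound for \<open>S\<close>.
\<close>

lemma closed_range_adjoint_below:
  fixes T S :: "'a::{real_inner,complete_space} \<Rightarrow> 'a"
  assumes T: "bounded_linear T" and cl: "closed (range T)"
    and S: "bounded_linear S" and adj: "\<And>x y. inner (T x) y = inner x (S y)"
  obtains c where "c > 0" "\<And>y. (\<And>k. S k = 0 \<Longrightarrow> inner y k = 0) \<Longrightarrow> c * norm y \<le> norm (S y)"
proof -
  interpret T: bounded_linear T by fact
  interpret S: bounded_linear S by fact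
  have sub: "subspace (range T)"
    using T.linear_axioms subspace_UNIV by (rule linear_subspace_image)
  obtain Q where QR: "\<And>x. Q x \<in> range T" and Q: "\<And>x r. r \<in> range T \<Longrightarrow> inner (x - Q x) r = 0"
    by (rule orthogonal_projection_exists[OF sub cl]) blast
  have ker: "S (x - Q x) = 0" for x
  proof -
    have "inner (S (x - Q x)) (S (x - Q x)) = inner (T (S (x - Q x))) (x - Q x)"
      by (simp add: adj)
    also have "\<dots> = 0" using Q[of "T (S (x - Q x))" x] by (simp add: inner_commute)
    finally show ?thesis by simp
  qed
  define Y where "Y = {y. (\<forall>k. S k = 0 \<longrightarrow> inner y k = 0) \<and> norm (S y) \<le> 1}"
  have "\<exists>B. \<forall>y\<in>Y. \<bar>inner y z\<bar> \<le> B" for z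
  proof -
    obtain x where x: "Q z = T x" using QR by blast
    have "\<bar>inner y z\<bar> \<le> norm x" if "y \<in> Y" for y
    proof -
      have "inner y (z - Q z) = 0" using that ker unfolding Y_def by blast
      then have "\<bar>inner y z\<bar> = \<bar>inner x (S y)\<bar>"
        by (simp add: inner_diff_right x adj[symmetric] inner_commute)
      also have "\<dots> \<le> norm x * norm (S y)" by (rule Cauchy_Schwarz_ineq2)
      also have "\<dots> \<le> norm x * 1" using that unfolding Y_def by (intro mult_left_mono) auto
      finally show ?thesis by simp
    qed
    then show ?thesis by blast
  qed
  then have "bounded Y" by (rule weakly_bounded_imp_bounded)
  then obtain B where B: "B > 0" "\<And>y. y \<in> Y \<Longrightarrow> norm y \<le> B" by (meson bounded_pos)
  have "(1 / B) * norm y \<le> norm (S y)" if y: "\<And>k. S k = 0 \<Longrightarrow> inner y k = 0" for y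
  proof (cases "S y = 0")
    case True
    then show ?thesis using y[of y] by simp
  next
    case False
    have "(1 / norm (S y)) *\<^sub>R y \<in> Y"
      unfolding Y_def using y False by (auto simp: S.scaleR)
    from B(2)[OF this] show ?thesis using False B(1) by (simp add: field_simps)
  qed
  then show ?thesis using that[of "1 / B"] B(1) by simp
qed

text \<open>
  One half of the closed range theorem: the range of \<open>S\<close> is the image of the complete space
  \<open>W = (ker S)\<^sup>\<bottom>\<close>, on which \<open>S\<close> is bounded below.
\<close>

lemma closed_range_adjoint:
  fixes T S :: "'a::{real_inner,complete_space} \<Rightarrow> 'a"
  assumes T: "bounded_linear T" and cl: "closed (range T)"
    and S: "bounded_linear S" and adj: "\<And>x y. inner (T x) y = inner x (S y)"
  shows "closed (range S)"
proof -
  interpret S: bounded_linear S by fact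
  define W where "W = {y. \<forall>k. S k = 0 \<longrightarrow> inner y k = 0}"
  have ker: "subspace {k. S k = 0}" "closed {k. S k = 0}"
    using S.linear_axioms by (auto intro!: linear_subspace_kernel closed_Collect_eq
        S.continuous_on continuous_intros)
  obtain P where PK: "\<And>x. S (P x) = 0" and P: "\<And>x k. S k = 0 \<Longrightarrow> inner (x - P x) k = 0"
    by (rule orthogonal_projection_exists[OF ker]) blast
  have "S x \<in> S ` W" for x
  proof -
    have "S (x - P x) = S x" by (simp add: S.diff PK)
    moreover have "x - P x \<in> W" unfolding W_def using P by blast
    ultimately show ?thesis by (metis imageI)
  qed
  then have "range S = S ` W" by blast
  moreover have "complete (S ` W)"
  proof -
    obtain c where "c > 0" "\<And>y. y \<in> W \<Longrightarrow> c * norm y \<le> norm (S y)"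
      by (rule closed_range_adjoint_below[OF T cl S adj]) (auto simp: W_def)
    moreover have "subspace W"
      unfolding W_def by (auto simp: subspace_def inner_add_left)
    moreover have "complete W"
    proof -
      have "W = (\<Inter>k\<in>{k. S k = 0}. {y. inner y k = 0})" unfolding W_def by auto
      moreover have "closed {y. inner y k = 0}" for k :: 'a
        by (intro closed_Collect_eq continuous_intros)
      ultimately have "closed W" by auto
      then show ?thesis by (simp add: complete_eq_closed)
    qed
    ultimately show ?thesis using S by (metis complete_isometric_image)
  qed
  ultimately show ?thesis by (simp add: complete_imp_closed)
qed

text \<open>
  Here \<open>S\<close> is the adjoint of \<open>T\<close> and \<open>P\<close> the orthogonal projection onto \<open>ker S\<close>. The operator
  \<open>T S + P\<close> has the quadratic form \<open>\<parallel>S x\<parallel>\<^sup>2 + \<parallel>P x\<parallel>\<^sup>2\<close>, which is coercive by the lower bound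
  for \<open>S\<close> on \<open>(ker S)\<^sup>\<bottom>\<close>.
\<close>

lemma bij_compose_adjoint_plus_projection:
  fixes T S P :: "'a::{real_inner,complete_space} \<Rightarrow> 'a"
  assumes T: "bounded_linear T" and cl: "closed (range T)"
    and S: "bounded_linear S" and adj: "\<And>x y. inner (T x) y = inner x (S y)"
    and P: "bounded_linear P" "\<And>x. S (P x) = 0" "\<And>x k. S k = 0 \<Longrightarrow> inner (x - P x) k = 0"
  shows "bij (\<lambda>x. T (S x) + P x)" "bounded_linear (inv (\<lambda>x. T (S x) + P x))"
proof -
  interpret S: bounded_linear S by fact
  define A where "A x = T (S x) + P x" for x
  have A: "bounded_linear A"
    unfolding A_def by (intro bounded_linear_add bounded_linear_compose[OF T S] P)
  obtain c where c: "c > 0" "\<And>y. (\<And>k. S k = 0 \<Longrightarrow> inner y k = 0) \<Longrightarrow> c * norm y \<le> norm (S y)"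
    by (rule closed_range_adjoint_below[OF T cl S adj]) blast
  define d where "d = min (c\<^sup>2) 1"
  have "d > 0" unfolding d_def using c(1) by simp
  moreover have "d * (norm x)\<^sup>2 \<le> inner (A x) x" for x
  proof -
    define y where "y = x - P x"
    have yP: "inner y (P x) = 0" unfolding y_def using P(2,3) by blast
    have x: "x = y + P x" unfolding y_def by simp
    have Sy: "S y = S x" unfolding y_def by (simp add: S.diff P(2))
    have "(norm x)\<^sup>2 = (norm y)\<^sup>2 + (norm (P x))\<^sup>2"
      using norm_add_Pythagorean[of y "P x"] yP x by (simp add: orthogonal_def)
    then have "d * (norm x)\<^sup>2 = d * (norm y)\<^sup>2 + d * (norm (P x))\<^sup>2"
      by (simp add: distrib_left)
    also have "\<dots> \<le> c\<^sup>2 * (norm y)\<^sup>2 + 1 * (norm (P x))\<^sup>2"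
      unfolding d_def by (intro add_mono mult_right_mono) auto
    also have "c\<^sup>2 * (norm y)\<^sup>2 \<le> (norm (S y))\<^sup>2"
    proof -
      have "c * norm y \<le> norm (S y)"
        using c(2) P(3) unfolding y_def by blast
      then have "(c * norm y)\<^sup>2 \<le> (norm (S y))\<^sup>2" using c(1) by (intro power_mono) auto
      then show ?thesis by (simp add: power_mult_distrib)
    qed
    also have "(norm (S y))\<^sup>2 + 1 * (norm (P x))\<^sup>2 = inner (A x) x"
    proof -
      have "inner (P x) x = inner (P x) (P x)"
        using yP unfolding y_def by (simp add: inner_diff_left inner_diff_right inner_commute)
      then show ?thesis
        unfolding A_def Sy power2_norm_eq_inner by (simp add: inner_add_left adj)
    qed
    finally show ?thesis by simp
  qed
  ultimately have "bij A" "bounded_linear (inv A)" using coercive_imp_bij[OF A] by blast+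
  then show "bij (\<lambda>x. T (S x) + P x)" "bounded_linear (inv (\<lambda>x. T (S x) + P x))"
    unfolding A_def by auto
qed

section \<open>Complex-linear operators and their adjoints\<close>

lemma cinner_scaleC_right: "cinner x (scaleC c y) = cnj c * cinner x y"
  by (metis cinner_commute cinner_scaleC_left complex_cnj_mult)

lemma inner_scaleC_left: "inner (scaleC c x) y = inner x (scaleC (cnj c) y)"
  by (simp add: inner_eq_Re_cinner cinner_scaleC_left cinner_scaleC_right)

lemma bounded_clinearI:
  assumes "bounded_linear f" "\<And>c x. f (scaleC c x) = scaleC c (f x)"
  shows "bounded_clinear f"
  using assms by (simp add: bounded_clinear_def bounded_clinear_axioms_def)

lemma bounded_clinear_compose:
  assumes "bounded_clinear f" "bounded_clinear g"
  shows "bounded_clinear (f \<circ> g)"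
proof -
  interpret f: bounded_clinear f by fact
  interpret g: bounded_clinear g by fact
  show ?thesis
    using bounded_linear_compose[OF f.bounded_linear_axioms g.bounded_linear_axioms]
    by (intro bounded_clinearI) (simp_all add: comp_def f.scaleC g.scaleC)
qed

lemma scaleC_diff_right: "scaleC c (x - y) = scaleC c x - scaleC c y"
  by (metis add_diff_cancel diff_add_cancel scaleC_add_right)

text \<open>
  For a complex-linear \<open>T\<close> the adjoint with respect to the real inner product is also the adjoint
  with respect to \<^const>\<open>cinner\<close>, so the description in the definition of \<^const>\<open>cadjoint\<close>
  does determine a bounded operator.
\<close>

lemma cinner_cadjoint:
  fixes T :: "'a::complex_hilbert_space \<Rightarrow> 'a"
  assumes "bounded_clinear T"
  shows "cinner (T x) y = cinner x (cadjoint T y)"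
    and "bounded_clinear (cadjoint T)"
proof -
  interpret T: bounded_clinear T by fact
  obtain S where S: "bounded_linear S" "\<And>x y. inner (T x) y = inner x (S y)"
    by (rule adjoint_exists[OF T.bounded_linear_axioms]) blast
  have cS: "cinner (T x) y = cinner x (S y)" for x y
  proof (rule complex_eqI)
    show "Re (cinner (T x) y) = Re (cinner x (S y))"
      using S(2) by (simp add: inner_eq_Re_cinner)
    \<comment> \<open>the imaginary part of \<open>w\<close> is the real part of \<open>- \<i> * w\<close>\<close>
    have "Re (cinner (T (scaleC (- \<i>) x)) y) = Re (cinner (scaleC (- \<i>) x) (S y))"
      using S(2) by (simp add: inner_eq_Re_cinner)
    then show "Im (cinner (T x) y) = Im (cinner x (S y))"
      by (simp add: T.scaleC cinner_scaleC_left)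
  qed
  have eqI: "a = b" if "\<And>x. cinner x a = cinner x b" for a b :: 'a
  proof -
    have "inner x a = inner x b" for x
      using that by (simp add: inner_eq_Re_cinner)
    then have "inner x (a - b) = 0" for x by (simp add: inner_diff_right)
    then show ?thesis by (metis inner_eq_zero_iff right_minus_eq)
  qed
  have adj: "cadjoint T = S"
    unfolding cadjoint_def
  proof (rule the_equality)
    fix R assume "\<forall>x y. cinner (T x) y = cinner x (R y)"
    then have "cinner x (R y) = cinner x (S y)" for x y using cS[of x y] by simp
    then show "R = S" by (intro ext) (rule eqI)
  qed (simp add: cS)
  show "cinner (T x) y = cinner x (cadjoint T y)" unfolding adj by (rule cS)
  have "S (scaleC c y) = scaleC c (S y)" for c y
    by (rule eqI) (simp add: cS[symmetric] cinner_scaleC_right)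
  then show "bounded_clinear (cadjoint T)"
    unfolding adj by (rule bounded_clinearI[OF S(1)])
qed

lemma inner_cadjoint:
  fixes T :: "'a::complex_hilbert_space \<Rightarrow> 'a"
  assumes "bounded_clinear T"
  shows "inner (T x) y = inner x (cadjoint T y)"
  using cinner_cadjoint(1)[OF assms] by (simp add: inner_eq_Re_cinner)

text \<open>
  The orthogonal projection onto the kernel of a complex-linear operator is complex-linear, since
  the kernel is invariant under complex scalars.
\<close>

lemma kernel_projection_exists:
  fixes T :: "'a::complex_hilbert_space \<Rightarrow> 'a"
  assumes "bounded_clinear T"
  obtains P where "bounded_clinear P" "\<And>x. T (P x) = 0"
    "\<And>x k. T k = 0 \<Longrightarrow> inner (x - P x) k = 0"
proof -
  interpret T: bounded_clinear T by fact
  have ker: "subspace {k. T k = 0}" "closed {k. T k = 0}"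
    using T.linear_axioms by (auto intro!: linear_subspace_kernel closed_Collect_eq
        T.continuous_on continuous_intros)
  obtain P where P: "bounded_linear P" and TP: "\<And>x. T (P x) = 0"
    and orth: "\<And>x k. T k = 0 \<Longrightarrow> inner (x - P x) k = 0"
    by (rule orthogonal_projection_exists[OF ker]) blast
  have T0: "T (scaleC c k) = 0" if "T k = 0" for c k
    using that by (metis T.scaleC diff_self scaleC_diff_right)
  have "P (scaleC c x) = scaleC c (P x)" for c x
  proof -
    define k where "k = P (scaleC c x) - scaleC c (P x)"
    have Tk: "T k = 0" unfolding k_def by (simp add: T.diff TP T0)
    have "inner (scaleC c (x - P x)) k = 0"
      unfolding inner_scaleC_left by (rule orth[OF T0[OF Tk]])
    moreover have "inner (scaleC c x - P (scaleC c x)) k = 0" by (rule orth[OF Tk])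
    ultimately have "inner k k = 0"
      unfolding k_def by (simp add: scaleC_diff_right inner_diff_left)
    then show ?thesis unfolding k_def by simp
  qed
  then show ?thesis using that bounded_clinearI[OF P] TP orth by blast
qed

section \<open>Factorisations of \<open>T\<^sup>* T\<close> through \<open>T T\<^sup>*\<close>\<close>

lemma kernel_cadjoint_comp:
  fixes T :: "'a::complex_hilbert_space \<Rightarrow> 'a"
  assumes "bounded_clinear T"
  shows "cadjoint T (T x) = 0 \<longleftrightarrow> T x = 0" and "T (cadjoint T x) = 0 \<longleftrightarrow> cadjoint T x = 0"
proof -
  interpret T: bounded_clinear T by fact
  interpret S: bounded_clinear "cadjoint T" by (rule cinner_cadjoint(2)[OF assms])
  note adj = inner_cadjoint[OF assms]
  show "cadjoint T (T x) = 0 \<longleftrightarrow> T x = 0"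
    using adj[of x "T x"] by (auto simp: S.zero)
  show "T (cadjoint T x) = 0 \<longleftrightarrow> cadjoint T x = 0"
    using adj[of "cadjoint T x" x] by (auto simp: T.zero)
qed

lemma inv_bounded_clinear:
  assumes "bounded_clinear A" "bij A" "bounded_linear (inv A)"
  shows "bounded_clinear (inv A)"
proof -
  interpret A: bounded_clinear A by fact
  have "inv A (scaleC c x) = scaleC c (inv A x)" for c x
    using assms(2) by (metis A.scaleC bij_inv_eq_iff)
  then show ?thesis by (rule bounded_clinearI[OF assms(3)])
qed

text \<open>
  With \<open>P\<close> the orthogonal projection onto \<open>ker T = ker T\<^sup>*\<close>, the operators \<open>A = T T\<^sup>* + P\<close> and
  \<open>B = T\<^sup>* T + P\<close> are isomorphisms with \<open>A (x - P x) = T T\<^sup>* x\<close> and \<open>B (x - P x) = T\<^sup>* T x\<close>.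
  Hence \<open>V = B A\<^sup>-\<^sup>1\<close> and \<open>W = A B\<^sup>-\<^sup>1\<close> are the required factors.
\<close>

lemma EP_imp_factorisation:
  fixes T :: "'a::complex_hilbert_space \<Rightarrow> 'a"
  assumes EP: "EP T"
  obtains V W where "isomorphism V" "cadjoint T \<circ> T = V \<circ> T \<circ> cadjoint T"
    "bounded_clinear W" "T \<circ> cadjoint T = W \<circ> cadjoint T \<circ> T"
proof -
  define S where "S = cadjoint T"
  have cT: "bounded_clinear T" and cl: "closed (range T)" and ker: "T k = 0 \<longleftrightarrow> S k = 0" for k
    using EP unfolding EP_def kernel_def S_def by auto
  have cS: "bounded_clinear S" unfolding S_def by (rule cinner_cadjoint(2)[OF cT])
  interpret T: bounded_clinear T by fact
  interpret S: bounded_clinear S by fact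
  have adj: "inner (T x) y = inner x (S y)" for x y
    unfolding S_def by (rule inner_cadjoint[OF cT])
  have adj': "inner (S x) y = inner x (T y)" for x y
    by (metis adj inner_commute)
  obtain P where cP: "bounded_clinear P" and SP: "\<And>x. S (P x) = 0"
    and orth: "\<And>x k. S k = 0 \<Longrightarrow> inner (x - P x) k = 0"
    by (rule kernel_projection_exists[OF cS]) blast
  interpret P: bounded_clinear P by fact
  have TP: "T (P x) = 0" for x using SP ker by blast
  have PP: "P (P x) = P x" for x
  proof -
    have "S (P x - P (P x)) = 0" by (simp add: S.diff SP)
    from orth[OF this, of "P x"] show ?thesis by simp
  qed
  define A where "A x = T (S x) + P x" for x
  define B where "B x = S (T x) + P x" for x
  note Tl = T.bounded_linear_axioms and Sl = S.bounded_linear_axioms and Pl = P.bounded_linear_axioms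
  have cA: "bounded_clinear A"
    unfolding A_def
    by (intro bounded_clinearI bounded_linear_add bounded_linear_compose[OF Tl Sl] Pl)
      (simp add: T.scaleC S.scaleC P.scaleC scaleC_add_right)
  have cB: "bounded_clinear B"
    unfolding B_def
    by (intro bounded_clinearI bounded_linear_add bounded_linear_compose[OF Sl Tl] Pl)
      (simp add: T.scaleC S.scaleC P.scaleC scaleC_add_right)
  have A: "bij A" "bounded_linear (inv A)"
    unfolding A_def using bij_compose_adjoint_plus_projection[OF Tl cl Sl adj Pl SP orth] by auto
  have clS: "closed (range S)" by (rule closed_range_adjoint[OF Tl cl Sl adj])
  have B: "bij B" "bounded_linear (inv B)"
    unfolding B_def
    using bij_compose_adjoint_plus_projection[OF Sl clS Tl adj' Pl TP] orth ker by auto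
  have AQ: "A (x - P x) = T (S x)" for x
    unfolding A_def by (simp add: S.diff SP P.diff PP)
  have BQ: "B (x - P x) = S (T x)" for x
    unfolding B_def by (simp add: T.diff TP P.diff PP)
  have inv_A: "inv A (A x) = x" and inv_B: "inv B (B x) = x" for x
    using A(1) B(1) by (simp_all add: bij_is_inj)
  define V where "V = B \<circ> inv A"
  define W where "W = A \<circ> inv B"
  have "isomorphism V"
    unfolding isomorphism_def V_def
    using bounded_clinear_compose[OF cB inv_bounded_clinear[OF cA A]]
      bij_comp[OF bij_imp_bij_inv[OF A(1)] B(1)] by (simp add: bij_def)
  moreover have "S \<circ> T = V \<circ> T \<circ> S"
  proof
    fix x show "(S \<circ> T) x = (V \<circ> T \<circ> S) x"
      unfolding V_def by (simp add: AQ[symmetric] BQ[symmetric] inv_A)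
  qed
  moreover have "bounded_clinear W"
    unfolding W_def by (rule bounded_clinear_compose[OF cA inv_bounded_clinear[OF cB B]])
  moreover have "T \<circ> S = W \<circ> S \<circ> T"
  proof
    fix x show "(T \<circ> S) x = (W \<circ> S \<circ> T) x"
      unfolding W_def by (simp add: AQ[symmetric] BQ[symmetric] inv_B)
  qed
  ultimately show ?thesis using that unfolding S_def by blast
qed

theorem proposition4p5:
  fixes T :: "'a::complex_hilbert_space \<Rightarrow> 'a"
  assumes "bounded_clinear T"
    and "closed (range T)"
  shows "(EP T \<longleftrightarrow>
           (\<exists>V. isomorphism V \<and> cadjoint T \<circ> T = V \<circ> T \<circ> cadjoint T))
       \<and> (EP T \<longleftrightarrow>
           (\<exists>N. bounded_clinear N \<and> inj N \<and> cadjoint T \<circ> T = N \<circ> T \<circ> cadjoint T))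
       \<and> (EP T \<longleftrightarrow>
           (\<exists>S1 S2. bounded_clinear S1 \<and> bounded_clinear S2
              \<and> cadjoint T \<circ> T = S1 \<circ> T \<circ> cadjoint T
              \<and> T \<circ> cadjoint T = S2 \<circ> cadjoint T \<circ> T))"
    (is "(_ \<longleftrightarrow> ?iso) \<and> (_ \<longleftrightarrow> ?inj) \<and> (_ \<longleftrightarrow> ?two)")
proof -
  note ker = kernel_cadjoint_comp[OF assms(1)]
  have EPI: "EP T" if "\<And>x. T x = 0 \<longleftrightarrow> cadjoint T x = 0"
    using assms that unfolding EP_def kernel_def by auto
  have "?iso" "?two" if EP: "EP T"
  proof -
    obtain V W where VW: "isomorphism V" "cadjoint T \<circ> T = V \<circ> T \<circ> cadjoint T"
        "bounded_clinear W" "T \<circ> cadjoint T = W \<circ> cadjoint T \<circ> T"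
      by (rule EP_imp_factorisation[OF EP])
    then show "?iso" by blast
    have "bounded_clinear V" using VW(1) unfolding isomorphism_def by blast
    with VW show "?two" by blast
  qed
  moreover have "?inj" if "?iso"
    using that unfolding isomorphism_def by blast
  moreover have "EP T" if inj: "?inj"
  proof -
    obtain N where N: "bounded_clinear N" "inj N"
        and eq: "cadjoint T \<circ> T = N \<circ> T \<circ> cadjoint T"
      using inj by blast
    interpret N: bounded_clinear N by (rule N(1))
    have N0: "N u = 0 \<longleftrightarrow> u = 0" for u
      using N(2) N.zero by (metis injD)
    show ?thesis
    proof (rule EPI)
      fix x
      have "cadjoint T (T x) = N (T (cadjoint T x))" using fun_cong[OF eq, of x] by simp
      then show "T x = 0 \<longleftrightarrow> cadjoint T x = 0" using ker N0 by metis
    qed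
  qed
  moreover have "EP T" if two: "?two"
  proof -
    obtain S1 S2 where S: "bounded_clinear S1" "bounded_clinear S2"
        and eq: "cadjoint T \<circ> T = S1 \<circ> T \<circ> cadjoint T" "T \<circ> cadjoint T = S2 \<circ> cadjoint T \<circ> T"
      using two by blast
    interpret S1: bounded_clinear S1 by (rule S(1))
    interpret S2: bounded_clinear S2 by (rule S(2))
    show ?thesis
    proof (rule EPI)
      fix x
      have "cadjoint T (T x) = S1 (T (cadjoint T x))" "T (cadjoint T x) = S2 (cadjoint T (T x))"
        using fun_cong[OF eq(1), of x] fun_cong[OF eq(2), of x] by simp_all
      then show "T x = 0 \<longleftrightarrow> cadjoint T x = 0" using ker S1.zero S2.zero by metis
    qed
  qed
  ultimately show ?thesis by blast
qed

end
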